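(* Let $G=V{:}H$ be a primitive permutation group of odd order with socle $V=(C_p)^d$ and point stabilizer $H$, and let $m=p^d$ be the degree of $G$. Then $$\min\left\{m\left(1-\frac{3}{2r+1}\right),\ m\left(1-\frac1p\right)^2\right\}\leqslant\mathrm{Ind}(G)\leqslant m\left(1-\frac1r\right),$$ where $r$ is the smallest prime divisor of $|G|$.
   Context: $G$ is an affine primitive group acting on $V=(\mathbb{F}_p)^d$, where $p$ is an odd prime, $d$ is a positive integer and $H\leqslant\mathrm{GL}_d(p)$. For $x\in G$, $\mathrm{ind}(x)=m-\mathrm{orb}(x)$, where $\mathrm{orb}(x)$ is the number of orbits of $\langle x\rangle$ on the $m$ points, and $\mathrm{Ind}(G)=\min\{\mathrm{ind}(x) : 1\neq x\in G\}$. *)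

theory Defs
  imports "HOL-Algebra.Group_Action" "HOL-Algebra.Product_Groups" "HOL-Computational_Algebra.Primes"
    Complex_Main
begin

text \<open>A permutation group on \<open>E\<close> is a group \<open>G\<close> together with a faithful action \<open>\<phi>\<close> on \<open>E\<close>; a group of
  permutations of \<open>E\<close> in the literal sense is the case of a subgroup of \<^term>\<open>BijGroup E\<close> with
  \<open>\<phi>\<close> the identity map.\<close>

definition block :: "[('a, 'c) monoid_scheme, 'b set, 'a \<Rightarrow> 'b \<Rightarrow> 'b, 'b set] \<Rightarrow> bool"
  where "block G E \<phi> B \<longleftrightarrow>
    B \<subseteq> E \<and> B \<noteq> {} \<and> (\<forall>g \<in> carrier G. \<phi> g ` B = B \<or> \<phi> g ` B \<inter> B = {})"

locale primitive_perm_group = faithful_action G E \<phi> + transitive_action G E \<phi>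
  for G (structure) and E and \<phi> +
  assumes trivial_blocks: "block G E \<phi> B \<Longrightarrow> B = E \<or> (\<exists>x. B = {x})"

definition minimal_normal :: "['a set, ('a, 'c) monoid_scheme] \<Rightarrow> bool"
  where "minimal_normal N G \<longleftrightarrow> N \<lhd> G \<and> N \<noteq> {\<one>\<^bsub>G\<^esub>} \<and>
    (\<forall>K. K \<lhd> G \<and> K \<subseteq> N \<longrightarrow> K = {\<one>\<^bsub>G\<^esub>} \<or> K = N)"

definition socle :: "('a, 'c) monoid_scheme \<Rightarrow> 'a set"
  where "socle G = generate G (\<Union>{N. minimal_normal N G})"

definition internal_semidirect :: "[('a, 'c) monoid_scheme, 'a set, 'a set] \<Rightarrow> bool"
  where "internal_semidirect G N K \<longleftrightarrow>
    N \<lhd> G \<and> subgroup K G \<and> N \<inter> K = {\<one>\<^bsub>G\<^esub>} \<and> N <#>\<^bsub>G\<^esub> K = carrier G"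

text \<open>The group $(C_p)^d$.\<close>
definition elementary_abelian :: "[nat, nat] \<Rightarrow> (nat \<Rightarrow> int) monoid"
  where "elementary_abelian p d = product_group {..<d} (\<lambda>_. integer_mod_group p)"

definition orb :: "[('a, 'c) monoid_scheme, 'b set, 'a \<Rightarrow> 'b \<Rightarrow> 'b, 'a] \<Rightarrow> nat"
  where "orb G E \<phi> x = card (orbits (subgroup_generated G {x}) E \<phi>)"

text \<open>For finite \<open>E\<close> there are at most \<^term>\<open>card E\<close> orbits, so the subtraction of natural numbers
  does not truncate.\<close>
definition ind :: "[('a, 'c) monoid_scheme, 'b set, 'a \<Rightarrow> 'b \<Rightarrow> 'b, 'a] \<Rightarrow> nat"
  where "ind G E \<phi> x = card E - orb G E \<phi> x"

text \<open>The minimum is meaningful only if \<open>G\<close> is finite and nontrivial.\<close>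
definition Ind :: "[('a, 'c) monoid_scheme, 'b set, 'a \<Rightarrow> 'b \<Rightarrow> 'b] \<Rightarrow> nat"
  where "Ind G E \<phi> = Min (ind G E \<phi> ` (carrier G - {\<one>\<^bsub>G\<^esub>}))"

end

theory Submission
  imports Defs "HOL-Algebra.Multiplicative_Group" "HOL-Algebra.Sylow"
begin

text \<open>
  An element \<open>y\<close> of prime order \<open>s\<close> has cycles of length \<open>1\<close> and \<open>s\<close> only, so if it has \<open>f\<close> fixed
  points then \<open>ind(y) = (m - f)(1 - 1/s)\<close> (\<open>ind_prime_order\<close>). Applied to an element of order \<open>r\<close>,
  which exists by Cauchy's theorem, this gives the upper bound.

  For the lower bound, passing from \<open>x\<close> to a power only splits orbits (\<open>ind_pow_le\<close>), so it suffices
  to bound \<open>ind(y)\<close> for \<open>y\<close> of prime order \<open>s\<close>, where \<open>s \<ge> r\<close>. The main point is that \<open>f\<close> is \<open>0\<close> or a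
  power of \<open>p\<close> less than \<open>m = p\<^sup>d\<close>: the normal subgroup \<open>V\<close> is regular, so a fixed point of \<open>y\<close> identifies
  the points with the elements of \<open>V\<close> and the fixed points of \<open>y\<close> with the centralizer of \<open>y\<close> in \<open>V\<close>
  (\<open>card_fixed_points_dvd\<close>), and Lagrange's theorem applies. Three cases remain
  (\<open>prime_order_index_bound\<close>).

  \<^item> If \<open>f = 0\<close>, then \<open>ind(y) = m(1 - 1/s)\<close>, which exceeds \<open>m(1 - 3/(2s+1))\<close>.

  \<^item> If \<open>f > 0\<close> and \<open>s = p\<close>, then \<open>f \<le> m/p\<close> and \<open>ind(y) \<ge> m(1 - 1/p)\<^sup>2\<close>.

  \<^item> If \<open>f > 0\<close> and \<open>s \<noteq> p\<close>, then \<open>s\<close> divides \<open>m - f = f(m/f - 1)\<close>, hence divides \<open>m/f - 1\<close>. This number is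
    even because \<open>p\<close> is odd, and \<open>s\<close> is odd because \<open>|G|\<close> is, so \<open>m/f \<ge> 2s + 1\<close>. Then
    \<open>ind(y) \<ge> m(1 - 1/(2s+1))(1 - 1/s) = m(1 - 3/(2s+1))\<close>.

  As \<open>1 - 3/(2s+1)\<close> increases with \<open>s\<close>, the prime \<open>s\<close> may be replaced by \<open>r\<close> in the result.
\<close>

section \<open>Orbits of a cyclic subgroup\<close>

context group_action
begin

lemma acting_group: "group G"
  using group_hom group_hom.axioms(1) by blast

lemma orbit_eq:
  assumes "x \<in> E" "y \<in> orbit G \<phi> x"
  shows "orbit G \<phi> y = orbit G \<phi> x"
proof -
  have sub: "orbit G \<phi> z \<subseteq> E" if "z \<in> E" for z
    using that element_image by (auto simp: orbit_def)
  then have "y \<in> E" using assms by blast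
  then show ?thesis
    using assms sub orbit_trans orbit_sym by (meson subset_antisym subset_iff)
qed

text \<open>Every orbit of the larger subgroup is a union of orbits of the smaller one, so saturation maps the
  small orbits onto the large ones.\<close>
lemma card_orbits_antimono:
  assumes "finite E" "subgroup J G" "subgroup K G" "J \<subseteq> K"
  shows "card (orbits (G\<lparr>carrier := K\<rparr>) E \<phi>) \<le> card (orbits (G\<lparr>carrier := J\<rparr>) E \<phi>)"
proof -
  interpret J: group_action "G\<lparr>carrier := J\<rparr>" E \<phi> by (rule induced_action[OF assms(2)])
  interpret K: group_action "G\<lparr>carrier := K\<rparr>" E \<phi> by (rule induced_action[OF assms(3)])
  let ?f = "\<lambda>X. \<Union>y\<in>X. orbit (G\<lparr>carrier := K\<rparr>) \<phi> y"
  have f: "?f (orbit (G\<lparr>carrier := J\<rparr>) \<phi> x) = orbit (G\<lparr>carrier := K\<rparr>) \<phi> x" if "x \<in> E" for x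
  proof -
    have "orbit (G\<lparr>carrier := J\<rparr>) \<phi> x \<subseteq> orbit (G\<lparr>carrier := K\<rparr>) \<phi> x"
      using assms(4) by (auto simp: orbit_def)
    then show ?thesis
      using K.orbit_eq[OF that] J.orbit_refl[OF that] by blast
  qed
  have "orbits (G\<lparr>carrier := K\<rparr>) E \<phi> \<subseteq> ?f ` orbits (G\<lparr>carrier := J\<rparr>) E \<phi>"
  proof
    fix X assume "X \<in> orbits (G\<lparr>carrier := K\<rparr>) E \<phi>"
    then obtain x where x: "x \<in> E" "X = orbit (G\<lparr>carrier := K\<rparr>) \<phi> x" by (auto simp: orbits_def)
    then have "orbit (G\<lparr>carrier := J\<rparr>) \<phi> x \<in> orbits (G\<lparr>carrier := J\<rparr>) E \<phi>" by (auto simp: orbits_def)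
    then show "X \<in> ?f ` orbits (G\<lparr>carrier := J\<rparr>) E \<phi>" using f[OF x(1)] x(2) by (metis image_eqI)
  qed
  moreover have "finite (orbits (G\<lparr>carrier := J\<rparr>) E \<phi>)"
    using J.orbits_coverture assms(1) by (metis finite_UnionD)
  ultimately show ?thesis by (rule surj_card_le[rotated])
qed

lemma subgroup_generated_singleton:
  assumes "x \<in> carrier G"
  shows "subgroup_generated G {x} = G\<lparr>carrier := generate G {x}\<rparr>"
  using assms by (simp add: subgroup_generated_def)

lemma ind_pow_le:
  assumes "finite E" "x \<in> carrier G"
  shows "ind G E \<phi> (x [^] (k::nat)) \<le> ind G E \<phi> x"
proof -
  interpret group G by (rule acting_group)
  have xk: "x [^] k \<in> carrier G" using assms(2) by simp
  have sub: "subgroup (generate G {x}) G"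
    using assms(2) by (intro generate_is_subgroup) simp
  have "x [^] k \<in> generate G {x}"
    unfolding generate_pow[OF assms(2)] by (auto intro: exI[of _ "int k"] simp: int_pow_int)
  then have "generate G {x [^] k} \<subseteq> generate G {x}"
    by (intro generate_subgroup_incl[OF _ sub]) simp
  then have "orb G E \<phi> x \<le> orb G E \<phi> (x [^] k)"
    unfolding orb_def subgroup_generated_singleton[OF assms(2)] subgroup_generated_singleton[OF xk]
    using xk assms sub by (intro card_orbits_antimono generate_is_subgroup) auto
  then show ?thesis by (simp add: ind_def)
qed

text \<open>The stabilizer in \<open>\<langle>x\<rangle>\<close> of a point has order dividing \<open>s\<close>, so it is \<open>\<langle>x\<rangle>\<close> at the fixed points of \<open>x\<close>
  and trivial elsewhere. Counting pairs of a point and an element of its stabilizer gives \<open>s\<close> for each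
  orbit. The equation is arranged to avoid subtraction on the natural numbers.\<close>
lemma orb_prime_order:
  assumes fin: "finite E" and x: "x \<in> carrier G" and s: "prime s" "group.ord G x = s"
  shows "s * orb G E \<phi> x + card (invariants E \<phi> x) = card E + s * card (invariants E \<phi> x)"
proof -
  interpret group G by (rule acting_group)
  define K where "K = generate G {x}"
  have subK: "subgroup K G" unfolding K_def using x by (intro generate_is_subgroup) simp
  have cardK: "card K = s" unfolding K_def using generate_pow_card[OF x] s by simp
  have finK: "finite K" using cardK s by (metis card.infinite not_prime_0)
  have xK: "x \<in> K" unfolding K_def by (simp add: generate.incl)
  interpret K: group_action "G\<lparr>carrier := K\<rparr>" E \<phi> by (rule induced_action[OF subK])
  interpret KG: group "G\<lparr>carrier := K\<rparr>" by (rule K.acting_group)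
  have oK: "order (G\<lparr>carrier := K\<rparr>) = s" by (simp add: order_def cardK)
  let ?st = "stabilizer (G\<lparr>carrier := K\<rparr>) \<phi>"
  have st: "card (?st a) = (if \<phi> x a = a then s else 1)" if a: "a \<in> E" for a
  proof (cases "\<phi> x a = a")
    case True
    then have "K \<subseteq> stabilizer G \<phi> a" unfolding K_def using x
      by (intro generate_subgroup_incl stabilizer_subgroup a) (auto simp: stabilizer_def)
    then have "?st a = K" by (auto simp: stabilizer_def)
    with True show ?thesis by (simp add: cardK)
  next
    case False
    have "card (?st a) * card (rcosets\<^bsub>G\<lparr>carrier := K\<rparr>\<^esub> (?st a)) = s"
      using KG.lagrange[OF K.stabilizer_subgroup[OF a]] by (simp add: oK mult.commute)
    then have "card (?st a) dvd s" by (metis dvd_triv_left)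
    moreover have "?st a \<subset> K" using False xK by (auto simp: stabilizer_def)
    then have "card (?st a) < s" using psubset_card_mono[OF finK] cardK by blast
    ultimately show ?thesis using False s(1) by (auto simp: prime_nat_iff)
  qed
  have "s * orb G E \<phi> x = (\<Sum>X\<in>orbits (G\<lparr>carrier := K\<rparr>) E \<phi>. \<Sum>a\<in>X. card (?st a))"
    using K.card_stablizer_sum finK oK
    by (simp add: orb_def subgroup_generated_singleton[OF x] K_def[symmetric])
  also have "\<dots> = (\<Sum>a\<in>E. card (?st a))" by (rule K.disjoint_sum[OF fin])
  also have "\<dots> = (\<Sum>a\<in>E. if \<phi> x a = a then s else 1)" by (intro sum.cong) (auto simp: st)
  also have "\<dots> = (\<Sum>a\<in>invariants E \<phi> x. s) + (\<Sum>a\<in>E - invariants E \<phi> x. 1)"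
    using fin by (subst sum.If_cases) (auto simp: invariants_def intro!: arg_cong2[where f="(+)"] arg_cong[where f=card])
  finally have "s * orb G E \<phi> x = s * card (invariants E \<phi> x) + card (E - invariants E \<phi> x)"
    by simp
  moreover have "invariants E \<phi> x \<subseteq> E" by (auto simp: invariants_def)
  then have "card (E - invariants E \<phi> x) + card (invariants E \<phi> x) = card E"
    using fin by (metis card_Diff_subset card_mono finite_subset le_add_diff_inverse2)
  ultimately show ?thesis by simp
qed

lemma ind_prime_order:
  assumes "finite E" "x \<in> carrier G" "prime s" "group.ord G x = s"
  shows "real (ind G E \<phi> x) = (real (card E) - real (card (invariants E \<phi> x))) * (1 - 1 / real s)"
proof -
  let ?f = "card (invariants E \<phi> x)"
  have s: "real s > 0" "s \<ge> 1" using prime_gt_0_nat[OF assms(3)] by auto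
  have eq: "s * orb G E \<phi> x + ?f = card E + s * ?f" by (rule orb_prime_order[OF assms])
  have f: "?f \<le> card E" using assms(1) by (intro card_mono) (auto simp: invariants_def)
  \<comment> \<open>It follows that the natural subtraction in \<^const>\<open>ind\<close> agrees with the real one.\<close>
  have "s * orb G E \<phi> x \<le> s * card E"
  proof -
    obtain k where "card E = ?f + k" using f le_Suc_ex by blast
    then have "s * orb G E \<phi> x = s * ?f + k" using eq by simp
    also have "\<dots> \<le> s * ?f + s * k" using s by simp
    finally show ?thesis using \<open>card E = ?f + k\<close> by (simp add: algebra_simps)
  qed
  then have "orb G E \<phi> x \<le> card E" using s by simp
  then have i: "real (ind G E \<phi> x) = real (card E) - real (orb G E \<phi> x)" by (simp add: ind_def)
  have "real s * real (orb G E \<phi> x) + real ?f = real (card E) + real s * real ?f"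
    using arg_cong[OF eq, of real] by simp
  then show ?thesis unfolding i using s by (simp add: field_simps)
qed

end

section \<open>Fixed points and regular normal subgroups\<close>

text \<open>If \<open>x\<close> fixes \<open>a\<close>, then \<open>x(va) = (x v x\<inverse>)a\<close> for \<open>v \<in> N\<close>. As the orbit map of \<open>a\<close> on \<open>N\<close> is injective, \<open>va\<close> is
  fixed iff \<open>v\<close>
  commutes with \<open>x\<close>, so the number of fixed points is the order of a subgroup of \<open>N\<close>.\<close>
lemma (in group_action) card_fixed_points_dvd:
  assumes N: "N \<lhd> G" and x: "x \<in> carrier G"
    and a: "a \<in> E" "\<phi> x a = a" and reg: "bij_betw (\<lambda>v. \<phi> v a) N E"
  shows "card (invariants E \<phi> x) dvd card E"
proof -
  interpret group G by (rule acting_group)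
  interpret N: normal N G by (rule N)
  define C where "C = {v \<in> N. x \<otimes> v = v \<otimes> x}"
  have NG: "v \<in> carrier G" if "v \<in> N" for v using that N.subset by blast
  have inj: "inj_on (\<lambda>v. \<phi> v a) N" and img: "(\<lambda>v. \<phi> v a) ` N = E"
    using reg by (auto simp: bij_betw_def)
  have "invariants E \<phi> x = (\<lambda>v. \<phi> v a) ` C"
  proof -
    have "\<phi> x (\<phi> v a) = \<phi> v a \<longleftrightarrow> v \<in> C" if v: "v \<in> N" for v
    proof -
      define w where "w = x \<otimes> v \<otimes> inv x"
      have w: "w \<in> N" unfolding w_def using N.inv_op_closed2 v x by blast
      have wx: "w \<otimes> x = x \<otimes> v" unfolding w_def using x NG[OF v] by (simp add: m_assoc)
      have "\<phi> x (\<phi> v a) = \<phi> (w \<otimes> x) a"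
        unfolding wx using composition_rule[OF a(1) x NG[OF v]] by simp
      also have "\<dots> = \<phi> w a" using composition_rule[OF a(1) NG[OF w] x] a(2) by simp
      finally have "\<phi> x (\<phi> v a) = \<phi> v a \<longleftrightarrow> w = v"
        using inj v w by (auto simp: inj_on_def)
      also have "\<dots> \<longleftrightarrow> w \<otimes> x = v \<otimes> x" using w v x NG by simp
      finally show ?thesis using v by (simp add: wx C_def)
    qed
    then show ?thesis using img by (auto simp: invariants_def C_def)
  qed
  then have "card (invariants E \<phi> x) = card C"
    using card_image[OF inj_on_subset[OF inj, of C]] by (auto simp: C_def)
  moreover have "subgroup C (G\<lparr>carrier := N\<rparr>)"
  proof (rule subgroup_incl)
    show "subgroup C G"
    proof
      fix v assume v: "v \<in> C"
      then have vG: "v \<in> carrier G" and xv: "x \<otimes> v = v \<otimes> x" by (auto simp: C_def NG)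
      have "x \<otimes> inv v = inv v \<otimes> (v \<otimes> x) \<otimes> inv v" using x vG by (simp add: m_assoc[symmetric])
      also have "\<dots> = inv v \<otimes> (x \<otimes> v) \<otimes> inv v" by (simp only: xv)
      also have "\<dots> = inv v \<otimes> x" using x vG by (simp add: m_assoc)
      finally have "x \<otimes> inv v = inv v \<otimes> x" .
      then show "inv v \<in> C" using v by (simp add: C_def)
    next
      fix v w assume "v \<in> C" "w \<in> C"
      then have v: "v \<in> N" "x \<otimes> v = v \<otimes> x" and w: "w \<in> N" "x \<otimes> w = w \<otimes> x" by (auto simp: C_def)
      have "x \<otimes> (v \<otimes> w) = v \<otimes> x \<otimes> w" using x NG v w by (simp add: m_assoc[symmetric])
      also have "\<dots> = v \<otimes> w \<otimes> x" using x NG v w by (simp add: m_assoc)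
      finally show "v \<otimes> w \<in> C" using v w by (simp add: C_def)
    qed (use x in \<open>auto simp: C_def NG\<close>)
  qed (auto simp: C_def N.subgroup_axioms)
  then have "card C dvd card N"
    using group.lagrange[OF N.subgroup_is_group[OF acting_group], of C]
    by (simp add: order_def) (metis dvd_triv_right)
  moreover have "card N = card E" using reg bij_betw_same_card by blast
  ultimately show ?thesis by simp
qed

text \<open>The values of \<open>\<phi>\<close> are extensional functions on \<open>E\<close>, so an element that fixes every point of \<open>E\<close> has
  the same image as \<open>\<one>\<close>.\<close>
lemma (in faithful_action) card_fixed_points_less:
  assumes "finite E" "x \<in> carrier G" "x \<noteq> \<one>"
  shows "card (invariants E \<phi> x) < card E"
proof -
  interpret group G by (rule acting_group)
  have "invariants E \<phi> x \<noteq> E"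
  proof
    assume all: "invariants E \<phi> x = E"
    have ext: "\<phi> x \<in> extensional E" using bij_prop0[OF assms(2)] by (simp add: Bij_def)
    have "\<phi> x = \<phi> \<one>"
    proof
      show "\<phi> x a = \<phi> \<one> a" for a
        using all ext unfolding id_eq_one[symmetric]
        by (cases "a \<in> E") (auto simp: invariants_def extensional_def)
    qed
    then show False using faithful assms(2,3) by (auto simp: inj_on_def)
  qed
  then have "invariants E \<phi> x \<subset> E" by (auto simp: invariants_def)
  then show ?thesis by (rule psubset_card_mono[OF assms(1)])
qed

text \<open>At the base point \<open>w\<close>, the factorization \<open>G = N stab(w)\<close> makes \<open>N\<close> transitive and
  \<open>N \<inter> stab(w) = 1\<close> makes its orbit map injective. Any other point is \<open>uw\<close> with \<open>u \<in> N\<close>, and its orbit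
  map is that of \<open>w\<close> after right multiplication by \<open>u\<close>.\<close>
lemma (in transitive_action) normal_complement_regular:
  assumes sd: "internal_semidirect G N (stabilizer G \<phi> w)" and w: "w \<in> E" and a: "a \<in> E"
  shows "bij_betw (\<lambda>v. \<phi> v a) N E"
proof -
  interpret group G by (rule acting_group)
  interpret N: normal N G using sd by (simp add: internal_semidirect_def)
  have NG: "v \<in> carrier G" if "v \<in> N" for v using that N.subset by blast
  have triv: "N \<inter> stabilizer G \<phi> w = {\<one>}" and prod: "N <#> stabilizer G \<phi> w = carrier G"
    using sd by (auto simp: internal_semidirect_def)
  have bij: "bij_betw (\<lambda>v. \<phi> v w) N E"
    unfolding bij_betw_def
  proof
    show "inj_on (\<lambda>v. \<phi> v w) N"
    proof (rule inj_onI)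
      fix u v assume u: "u \<in> N" and v: "v \<in> N" and eq: "\<phi> u w = \<phi> v w"
      have "\<phi> (inv v \<otimes> u) w = \<phi> (inv v) (\<phi> v w)"
        using composition_rule[OF w] u v NG eq by simp
      also have "\<dots> = w" using orbit_sym_aux[OF NG[OF v] w] by simp
      finally have "inv v \<otimes> u \<in> N \<inter> stabilizer G \<phi> w" using u v NG by (simp add: stabilizer_def)
      then have "inv v \<otimes> u = \<one>" using triv by blast
      then show "u = v" using u v NG by (metis inv_closed inv_equality inv_inv)
    qed
    show "(\<lambda>v. \<phi> v w) ` N = E"
    proof
      show "(\<lambda>v. \<phi> v w) ` N \<subseteq> E" using element_image NG w by blast
      show "E \<subseteq> (\<lambda>v. \<phi> v w) ` N"
      proof
        fix b assume "b \<in> E"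
        then obtain g where "g \<in> carrier G" and g: "\<phi> g w = b" using unique_orbit w by blast
        then obtain v h where vh: "v \<in> N" "h \<in> stabilizer G \<phi> w" "g = v \<otimes> h"
          unfolding prod[symmetric] set_mult_def by blast
        then have "b = \<phi> v w"
          using composition_rule[OF w NG[OF vh(1)], of h] g by (simp add: stabilizer_def)
        with vh show "b \<in> (\<lambda>v. \<phi> v w) ` N" by blast
      qed
    qed
  qed
  then obtain u where u: "u \<in> N" "a = \<phi> u w" using a by (auto simp: bij_betw_def)
  have "bij_betw (\<lambda>v. v \<otimes> u) N N"
    by (rule bij_betw_byWitness[where f'="\<lambda>v. v \<otimes> inv u"]) (use u NG in \<open>auto simp: m_assoc\<close>)
  from bij_betw_trans[OF this bij] show ?thesis
    by (rule bij_betw_cong[THEN iffD1, rotated]) (use composition_rule[OF w] u NG in auto)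
qed

section \<open>Elements of prime order\<close>

lemma (in group) obtains_prime_order_power:
  assumes "finite (carrier G)" "x \<in> carrier G" "x \<noteq> \<one>"
  obtains k s where "prime s" "ord (x [^] (k::nat)) = s" "s dvd order G"
proof -
  have "ord x \<noteq> 1" using assms ord_eq_1 by blast
  then obtain s where s: "prime s" "s dvd ord x" using prime_factor_nat by blast
  then obtain k where k: "ord x = k * s" by (metis dvdE mult.commute)
  have "ord x \<noteq> 0" using ord_ge_1[OF assms(1,2)] by simp
  then have "ord (x [^] k) = s" using ord_pow[OF assms(2), of k] k by simp
  with s that ord_dvd_group_order[OF assms(2)] show thesis using dvd_trans by metis
qed

lemma (in group) cauchy:
  assumes "finite (carrier G)" "prime q" "q dvd order G"
  obtains x where "x \<in> carrier G" "ord x = q"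
proof -
  obtain k where "order G = q ^ 1 * k" using assms(3) by (auto elim: dvdE)
  from sylow_thm[OF assms(2) is_group this assms(1)]
  obtain S where S: "subgroup S G" "card S = q" by auto
  interpret S: subgroup S G by (rule S)
  have "S \<noteq> {\<one>}" using S assms(2) by auto
  then obtain x where x: "x \<in> S" "x \<noteq> \<one>" using S.one_closed by blast
  have "x [^] q = \<one>"
    using group.pow_order_eq_1[OF S.subgroup_is_group[OF is_group], of x] x S(2)
    by (simp add: order_def nat_pow_consistent[symmetric])
  then have "ord x dvd q" using x S.subset pow_eq_id by blast
  moreover have "ord x \<noteq> 1" using x S.subset ord_eq_1 by blast
  ultimately have "ord x = q" using assms(2) by (meson prime_nat_iff)
  with x S.subset that show thesis by blast
qed

section \<open>The index bounds\<close>

text \<open>The arithmetic of the lower bound, for an element of prime order \<open>s\<close> with \<open>f\<close> fixed points.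
  The divisibility holds because the points outside the fixed ones fall into cycles of length \<open>s\<close>. The
  case \<open>s = p\<close> is the one that forces the second term of the minimum.\<close>
lemma prime_order_index_bound:
  fixes f p d s r :: nat
  assumes p: "prime p" "odd p" and s: "prime s" "odd s" "r \<le> s" and r: "0 < r"
    and f: "f = 0 \<or> f dvd p ^ d" "f < p ^ d" and cycles: "s dvd p ^ d - f"
  shows "min (real (p ^ d) * (1 - 3 / (2 * real r + 1))) (real (p ^ d) * (1 - 1 / real p)\<^sup>2)
    \<le> (real (p ^ d) - real f) * (1 - 1 / real s)"
proof -
  define m where "m = p ^ d"
  have m: "real m > 0" using p by (simp add: m_def prime_gt_0_nat)
  have s1: "real s > 1" using s prime_gt_1_nat by auto
  have p1: "real p > 1" using p prime_gt_1_nat by auto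
  have "3 / (2 * real s + 1) \<le> 3 / (2 * real r + 1)"
    using s r by (intro divide_left_mono) auto
  then have mono: "real m * (1 - 3 / (2 * real r + 1)) \<le> real m * (1 - 3 / (2 * real s + 1))"
    using m by simp
  consider "f = 0" | "s = p" "f \<noteq> 0" | "s \<noteq> p" "f \<noteq> 0" by blast
  then show ?thesis unfolding m_def[symmetric]
  proof cases
    case 1
    have "1 / real s \<le> 3 / (2 * real s + 1)" using s1 by (simp add: field_simps)
    then have "real m * (1 - 3 / (2 * real s + 1)) \<le> (real m - real f) * (1 - 1 / real s)"
      using 1 m by simp
    with mono show "min (real m * (1 - 3 / (2 * real r + 1))) (real m * (1 - 1 / real p)\<^sup>2)
       \<le> (real m - real f) * (1 - 1 / real s)" by linarith
  next
    case 2
    obtain a where a: "f = p ^ a" using f(1) 2 p(1) divides_primepow_nat by blast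
    then have "a < d" using f(2) p1 by (simp add: power_strict_increasing_iff)
    then have "p ^ Suc a \<le> p ^ d" using p1 by (intro power_increasing) auto
    then have "real p * real f \<le> real m" unfolding a m_def by (simp flip: of_nat_mult of_nat_power)
    then have "real m * (1 - 1 / real p) \<le> real m - real f" using p1 by (simp add: field_simps)
    then have "real m * (1 - 1 / real p) * (1 - 1 / real p) \<le> (real m - real f) * (1 - 1 / real p)"
      using p1 by (intro mult_right_mono) auto
    then show "min (real m * (1 - 3 / (2 * real r + 1))) (real m * (1 - 1 / real p)\<^sup>2)
       \<le> (real m - real f) * (1 - 1 / real s)"
      using 2 by (simp add: power2_eq_square mult.assoc)
  next
    case 3
    obtain a where a: "f = p ^ a" using f(1) 3 p(1) divides_primepow_nat by blast
    obtain k where k: "m = f * k" using f(1) 3 by (auto simp: m_def)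
    have "k > 1" using f(2) k unfolding m_def[symmetric] by (cases "k \<le> 1") (auto simp: le_Suc_eq)
    have "coprime s f" unfolding a using s(1) p(1) 3 primes_coprime by auto
    moreover have "s dvd f * (k - 1)" using cycles k by (simp add: m_def[symmetric] algebra_simps)
    ultimately have "s dvd k - 1" using coprime_dvd_mult_right_iff by blast
    moreover have "odd k" using k p(2) unfolding m_def by (metis even_mult_iff even_power)
    then have "2 dvd k - 1" by simp
    moreover have "coprime 2 s" using s(2) by simp
    ultimately have "2 * s dvd k - 1" using divides_mult by blast
    then have "2 * s \<le> k - 1" using \<open>k > 1\<close> by (intro dvd_imp_le) auto
    then have "f * (2 * s + 1) \<le> m" unfolding k using \<open>k > 1\<close> by (intro mult_le_mono2) simp
    then have "real f * (2 * real s + 1) \<le> real m"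
      by (metis (no_types) of_nat_le_iff of_nat_mult of_nat_add of_nat_numeral of_nat_1)
    then have "real m * (1 - 1 / (2 * real s + 1)) \<le> real m - real f" using s1 by (simp add: field_simps)
    then have "real m * (1 - 1 / (2 * real s + 1)) * (1 - 1 / real s)
        \<le> (real m - real f) * (1 - 1 / real s)"
      using s1 by (intro mult_right_mono) auto
    moreover have "(1 - 1 / (2 * real s + 1)) * (1 - 1 / real s) = 1 - 3 / (2 * real s + 1)"
    proof -
      have "1 - 1 / (2 * real s + 1) = 2 * real s / (2 * real s + 1)"
        and "1 - 3 / (2 * real s + 1) = 2 * (real s - 1) / (2 * real s + 1)"
        and "1 - 1 / real s = (real s - 1) / real s"
        using s1 by (simp_all add: field_simps)
      then show ?thesis using s1 by simp
    qed
    ultimately have "real m * (1 - 3 / (2 * real s + 1)) \<le> (real m - real f) * (1 - 1 / real s)"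
      by (simp add: mult.assoc)
    with mono show "min (real m * (1 - 3 / (2 * real r + 1))) (real m * (1 - 1 / real p)\<^sup>2)
       \<le> (real m - real f) * (1 - 1 / real s)" by linarith
  qed
qed

theorem theorem7p4:
  fixes G :: "('a, 'c) monoid_scheme" and E :: "'b set" and \<phi> :: "'a \<Rightarrow> 'b \<Rightarrow> 'b"
    and V H :: "'a set" and \<omega> :: 'b and p d m r :: nat
  assumes "primitive_perm_group G E \<phi>"
    and "odd (order G)"
    and "prime p" and "odd p" and "d > 0"
    and "V = socle G" and "G\<lparr>carrier := V\<rparr> \<cong> elementary_abelian p d"
    and "\<omega> \<in> E" and "H = stabilizer G \<phi> \<omega>"
    and "internal_semidirect G V H"
    and "m = card E" and "m = p ^ d"
    and "r = (LEAST q. prime q \<and> q dvd order G)"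
  shows "min (real m * (1 - 3 / (2 * real r + 1))) (real m * (1 - 1 / real p)\<^sup>2)
           \<le> real (Ind G E \<phi>)
       \<and> real (Ind G E \<phi>) \<le> real m * (1 - 1 / real r)"
proof -
  interpret P: primitive_perm_group G E \<phi> by (rule assms(1))
  interpret G: group G by (rule P.acting_group)
  have finG: "finite (carrier G)"
    using assms(2) G.order_gt_0_iff_finite by (metis even_zero gr0I)
  have m1: "m > 1" unfolding assms(12) using assms(3,5) by (intro one_less_power prime_gt_1_nat)
  have finE: "finite E" using m1 assms(11) by (metis card.infinite not_one_less_zero)
  have reg: "bij_betw (\<lambda>v. \<phi> v a) V E" if "a \<in> E" for a
    using P.normal_complement_regular[OF _ assms(8) that] assms(9,10) by simp
  have V: "V \<lhd> G" using assms(10) by (simp add: internal_semidirect_def)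
  \<comment> \<open>\<open>G\<close> is nontrivial, so that \<open>r\<close> is a prime divisor of \<open>|G|\<close> and not a default value of \<open>LEAST\<close>.\<close>
  have "card V = m" using reg[OF assms(8)] assms(11) bij_betw_same_card by blast
  moreover have "card V \<le> order G"
    unfolding order_def using finG normal_imp_subgroup[OF V] by (intro card_mono subgroup.subset)
  ultimately have oG: "order G \<noteq> 1" using m1 by simp
  then have "\<exists>q. prime q \<and> q dvd order G" using prime_factor_nat by blast
  then have "prime r \<and> r dvd order G" unfolding assms(13) by (rule LeastI_ex)
  then have r: "prime r" "r dvd order G" by auto
  have r_min: "r \<le> q" if "prime q" "q dvd order G" for q
    unfolding assms(13) using that by (simp add: Least_le)
  let ?L = "min (real m * (1 - 3 / (2 * real r + 1))) (real m * (1 - 1 / real p)\<^sup>2)"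
  let ?I = "ind G E \<phi> ` (carrier G - {\<one>\<^bsub>G\<^esub>})"
  have lower: "?L \<le> real (ind G E \<phi> x)" if x: "x \<in> carrier G" "x \<noteq> \<one>\<^bsub>G\<^esub>" for x
  proof -
    obtain k :: nat and s where s: "prime s" "group.ord G (x [^]\<^bsub>G\<^esub> k) = s" "s dvd order G"
      using G.obtains_prime_order_power[OF finG x] by blast
    define y where "y = x [^]\<^bsub>G\<^esub> k"
    have y: "y \<in> carrier G" "group.ord G y = s" using x s by (auto simp: y_def)
    define f where "f = card (invariants E \<phi> y)"
    have eq: "s * orb G E \<phi> y + f = m + s * f"
      using P.orb_prime_order[OF finE y(1) s(1) y(2)] by (simp add: f_def assms(11))
    have "f = 0 \<or> f dvd m"
    proof (cases "invariants E \<phi> y = {}")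
      case False
      then obtain a where a: "a \<in> E" "\<phi> y a = a" by (auto simp: invariants_def)
      show ?thesis using P.card_fixed_points_dvd[OF V y(1) a reg[OF a(1)]] by (simp add: f_def assms(11))
    qed (simp add: f_def)
    moreover have "y \<noteq> \<one>\<^bsub>G\<^esub>" using y(2) s(1) by (metis G.ord_id not_prime_1)
    then have "f < m"
      unfolding f_def assms(11) using P.card_fixed_points_less[OF finE y(1)] by blast
    moreover have "s dvd m - f"
    proof -
      have "m - f + s * f = s * orb G E \<phi> y" using eq \<open>f < m\<close> by simp
      then show ?thesis by (metis dvd_add_times_triv_right_iff dvd_triv_left mult.commute)
    qed
    moreover have "odd s" using s(3) assms(2) by (meson dvd_trans)
    ultimately have "?L \<le> (real m - real f) * (1 - 1 / real s)"
      unfolding assms(12) using assms(3,4) s r_min[OF s(1,3)] r(1)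
      by (intro prime_order_index_bound) (auto simp: prime_gt_0_nat)
    also have "\<dots> = real (ind G E \<phi> y)"
      using P.ind_prime_order[OF finE y(1) s(1) y(2)] by (simp add: f_def assms(11))
    also have "\<dots> \<le> real (ind G E \<phi> x)"
      unfolding y_def using P.ind_pow_le[OF finE x(1)] by simp
    finally show ?thesis .
  qed
  obtain x where x: "x \<in> carrier G" "group.ord G x = r" using G.cauchy[OF finG r] by blast
  then have x1: "x \<noteq> \<one>\<^bsub>G\<^esub>" using r(1) by auto
  have finI: "finite ?I" and neI: "?I \<noteq> {}" using finG x x1 by auto
  have "Ind G E \<phi> \<in> ?I" unfolding Ind_def by (rule Min_in[OF finI neI])
  moreover have "\<forall>i\<in>?I. ?L \<le> real i" using lower by simp
  ultimately have low: "?L \<le> real (Ind G E \<phi>)" by blast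
  have "Ind G E \<phi> \<le> ind G E \<phi> x" unfolding Ind_def using finI x x1 by (intro Min_le) auto
  then have "real (Ind G E \<phi>) \<le> (real m - real (card (invariants E \<phi> x))) * (1 - 1 / real r)"
    using P.ind_prime_order[OF finE x(1) r(1) x(2)] by (simp add: assms(11))
  also have "\<dots> \<le> real m * (1 - 1 / real r)"
    using prime_ge_1_nat[OF r(1)] by (intro mult_right_mono) auto
  finally show ?thesis using low by blast
qed

end
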